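(* Let $d \geq 1$ and let $G=(V,E)$ be a $d$-rigid graph with $|V| \geq d+1$. If $H$ is a spanning subgraph of $G$ that is $d$-rigid, then $c_d(G)$ divides $c_d(H)$.
   Context: All graphs are finite and simple. On $\mathbb{C}^d$ use the (non-Hermitian) quadratic form $\|x\|^2=\sum_{i=1}^d x_i^2$. A framework $(G,p)$ is a graph $G=(V,E)$ with a map $p:V\to\mathbb{C}^d$; it is generic if its $d|V|$ coordinates are algebraically independent over $\mathbb{Q}$. Two realisations $p,q$ are equivalent if $\|p(v)-p(w)\|^2=\|q(v)-q(w)\|^2$ for every edge $vw\in E$, and congruent if $q=Ap+b$ for some $b\in\mathbb{C}^d$ and $A$ a complex $d\times d$ matrix with $A^TA=AA^T=I$. A framework is rigid if every continuous path of equivalent realisations starting at $p$ stays congruent to $p$; $G$ is $d$-rigid if some generic framework of $G$ in $\mathbb{R}^d$ or $\mathbb{C}^d$ is rigid. For a $d$-rigid graph $G$ with $|V|\ge d+1$, the (complex) $d$-realisation number $c_d(G)$ is the number of congruence classes of realisations $q:V\to\mathbb{C}^d$ equivalent to $p$, for generic $p$ (this number is the same for all generic $p$); if $|V|\le d$, $c_d(G)=1$ when $G$ is complete and $\infty$ otherwise. *)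

theory Defs
  imports "HOL-Analysis.Analysis" "HOL-Library.Extended_Nat"
begin

text \<open>Dimension d is CARD('n) for a finite index type 'n; points of C^d are complex^'n.
Graphs: finite vertex set V, edges are 2-element subsets of V.\<close>

definition simple_graph :: "'v set \<Rightarrow> 'v set set \<Rightarrow> bool" where
  "simple_graph V E \<longleftrightarrow> finite V \<and> (\<forall>e\<in>E. e \<subseteq> V \<and> card e = 2)"

definition sqform :: "complex ^ 'n \<Rightarrow> complex" where
  "sqform x = (\<Sum>i\<in>UNIV. (x $ i)^2)"

text \<open>Algebraic independence over Q of a family x indexed by a finite set I:
no nonzero rational polynomial in the variables indexed by I vanishes at x.
A polynomial is a finitely supported coefficient map on monomials (exponent maps).\<close>
definition alg_indep_rat :: "('i \<Rightarrow> complex) \<Rightarrow> 'i set \<Rightarrow> bool" where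
  "alg_indep_rat x I \<longleftrightarrow>
     (\<forall>c :: ('i \<Rightarrow> nat) \<Rightarrow> rat.
        finite {m. c m \<noteq> 0} \<and> (\<forall>m. c m \<noteq> 0 \<longrightarrow> (\<forall>i. i \<notin> I \<longrightarrow> m i = 0)) \<and>
        (\<Sum>m\<in>{m. c m \<noteq> 0}. of_rat (c m) * (\<Prod>i\<in>I. x i ^ m i)) = 0
        \<longrightarrow> (\<forall>m. c m = 0))"

definition generic :: "'v set \<Rightarrow> ('v \<Rightarrow> complex ^ 'n) \<Rightarrow> bool" where
  "generic V p \<longleftrightarrow> alg_indep_rat (\<lambda>(v, i). p v $ i) (V \<times> (UNIV :: 'n set))"

definition equivalent :: "'v set set \<Rightarrow> ('v \<Rightarrow> complex ^ 'n) \<Rightarrow> ('v \<Rightarrow> complex ^ 'n) \<Rightarrow> bool" where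
  "equivalent E p q \<longleftrightarrow>
     (\<forall>v w. {v, w} \<in> E \<longrightarrow> sqform (p v - p w) = sqform (q v - q w))"

definition congruent :: "'v set \<Rightarrow> ('v \<Rightarrow> complex ^ 'n) \<Rightarrow> ('v \<Rightarrow> complex ^ 'n) \<Rightarrow> bool" where
  "congruent V p q \<longleftrightarrow>
     (\<exists>(A :: complex ^ 'n ^ 'n) b. transpose A ** A = mat 1 \<and> A ** transpose A = mat 1 \<and>
        (\<forall>v\<in>V. q v = A *v p v + b))"

definition rigid :: "'v set \<Rightarrow> 'v set set \<Rightarrow> ('v \<Rightarrow> complex ^ 'n) \<Rightarrow> bool" where
  "rigid V E p \<longleftrightarrow>
     (\<forall>\<gamma> :: real \<Rightarrow> 'v \<Rightarrow> complex ^ 'n.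
        (\<forall>v\<in>V. continuous_on {0..1} (\<lambda>t. \<gamma> t v)) \<and> (\<forall>v\<in>V. \<gamma> 0 v = p v) \<and>
        (\<forall>t\<in>{0..1}. equivalent E p (\<gamma> t))
        \<longrightarrow> (\<forall>t\<in>{0..1}. congruent V p (\<gamma> t)))"

text \<open>d-rigid: some generic framework (in R^d or C^d; R^d is contained in C^d) is rigid.
The type argument fixes d = CARD('n).\<close>
definition d_rigid :: "('n::finite) itself \<Rightarrow> 'v set \<Rightarrow> 'v set set \<Rightarrow> bool" where
  "d_rigid _ V E \<longleftrightarrow> (\<exists>p :: 'v \<Rightarrow> complex ^ 'n. generic V p \<and> rigid V E p)"

definition congruence_classes ::
  "'v set \<Rightarrow> 'v set set \<Rightarrow> ('v \<Rightarrow> complex ^ 'n) \<Rightarrow> ('v \<Rightarrow> complex ^ 'n) set set" where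
  "congruence_classes V E p =
     (let R = {q. (\<forall>v. v \<notin> V \<longrightarrow> q v = 0) \<and> equivalent E p q}
      in R // {(q, q'). q \<in> R \<and> q' \<in> R \<and> congruent V q q'})"

definition complete_graph :: "'v set \<Rightarrow> 'v set set \<Rightarrow> bool" where
  "complete_graph V E \<longleftrightarrow> (\<forall>v\<in>V. \<forall>w\<in>V. v \<noteq> w \<longrightarrow> {v, w} \<in> E)"

text \<open>The complex d-realisation number (d = CARD('n)), evaluated at a chosen generic p
(the number is independent of the generic p).\<close>
definition realisation_number :: "('n::finite) itself \<Rightarrow> 'v set \<Rightarrow> 'v set set \<Rightarrow> enat" where
  "realisation_number T V E =
     (if card V \<ge> CARD('n) + 1 then
        (let p = (SOME p :: 'v \<Rightarrow> complex ^ 'n. generic V p) in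
         if finite (congruence_classes V E p) then enat (card (congruence_classes V E p)) else \<infinity>)
      else if complete_graph V E then 1 else \<infinity>)"

end

theory Submission
  imports Defs "HOL-Computational_Algebra.Fundamental_Theorem_Algebra"
begin

text \<open>
  Let \<open>p\<close> be generic and let \<open>H\<close> be the subgraph; only the case of finitely many congruence classes
  for \<open>H\<close> needs an argument. Take \<open>q\<close> with the same \<open>H\<close>-edge lengths as \<open>p\<close>. As \<open>p\<close> is generic,
  mapping all pairwise squared distances of \<open>p\<close> to those of \<open>q\<close> defines a ring homomorphism, and it fixes the \<open>H\<close>-edge lengths. By finiteness every
  element of its domain is algebraic over the \<open>H\<close>-edge lengths, so the homomorphism is injective.
  Injectivity keeps a Gram determinant of \<open>q\<close> nonzero, so congruence classes correspond to distance
  functions. Extending the homomorphism, and its inverse, to the coordinates of finitely many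
  realisations shows that \<open>p\<close> and \<open>q\<close> have equally many \<open>G\<close>-equivalent distance functions. Hence
  \<open>G\<close>-equivalence cuts the classes for \<open>H\<close> into blocks of the size of the set of classes for \<open>G\<close>.
\<close>

section \<open>Partial isomorphisms between subrings\<close>

text \<open>A ring homomorphism between subrings is represented by its graph, a subring of the product
ring; since inverses are not required, the rings need not be fields.\<close>

definition pair_ring :: "('a::comm_ring_1 \<times> 'b::comm_ring_1) set \<Rightarrow> bool" where
  "pair_ring S \<longleftrightarrow> (1, 1) \<in> S \<and>
     (\<forall>a b c d. (a, b) \<in> S \<longrightarrow> (c, d) \<in> S \<longrightarrow> (a - c, b - d) \<in> S \<and> (a * c, b * d) \<in> S)"

text \<open>Applied to differences of pairs, the zero condition makes the relation single-valued and
  injective, hence the graph of an isomorphism between two subrings.\<close>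

definition partial_iso :: "('a::idom \<times> 'b::idom) set \<Rightarrow> bool" where
  "partial_iso S \<longleftrightarrow> pair_ring S \<and> (\<forall>(a, b)\<in>S. a = 0 \<longleftrightarrow> b = 0)"

lemma pair_ring_1: "pair_ring S \<Longrightarrow> (1, 1) \<in> S"
  and pair_ring_diff: "pair_ring S \<Longrightarrow> (a, b) \<in> S \<Longrightarrow> (c, d) \<in> S \<Longrightarrow> (a - c, b - d) \<in> S"
  and pair_ring_mult: "pair_ring S \<Longrightarrow> (a, b) \<in> S \<Longrightarrow> (c, d) \<in> S \<Longrightarrow> (a * c, b * d) \<in> S"
  by (auto simp: pair_ring_def)

lemma pair_ring_0: "pair_ring S \<Longrightarrow> (0, 0) \<in> S"
  using pair_ring_diff[OF _ pair_ring_1 pair_ring_1, of S] by simp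

lemma pair_ring_uminus: "pair_ring S \<Longrightarrow> (a, b) \<in> S \<Longrightarrow> (- a, - b) \<in> S"
  using pair_ring_diff[OF _ pair_ring_0, of S a b] by simp

lemma pair_ring_add: "pair_ring S \<Longrightarrow> (a, b) \<in> S \<Longrightarrow> (c, d) \<in> S \<Longrightarrow> (a + c, b + d) \<in> S"
  using pair_ring_diff[OF _ _ pair_ring_uminus, of S a b c d] by simp

lemma pair_ring_sum:
  assumes "pair_ring S" "\<And>i. i \<in> I \<Longrightarrow> (f i, g i) \<in> S"
  shows "(sum f I, sum g I) \<in> S"
  using assms(2) by (induction I rule: infinite_finite_induct)
    (auto intro: pair_ring_0 pair_ring_add assms(1))

lemma pair_ring_prod:
  assumes "pair_ring S" "\<And>i. i \<in> I \<Longrightarrow> (f i, g i) \<in> S"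
  shows "(prod f I, prod g I) \<in> S"
  using assms(2) by (induction I rule: infinite_finite_induct)
    (auto intro: pair_ring_1 pair_ring_mult assms(1))

lemma pair_ring_power: "pair_ring S \<Longrightarrow> (a, b) \<in> S \<Longrightarrow> (a ^ n, b ^ n) \<in> S"
  by (induction n) (auto intro: pair_ring_1 pair_ring_mult)

lemma pair_ring_of_int:
  assumes "pair_ring S" shows "(of_int k, of_int k) \<in> S"
  by (induction k rule: int_induct[where k = 0])
    (auto intro: pair_ring_0 pair_ring_1 pair_ring_add pair_ring_diff assms)

lemma partial_iso_ring: "partial_iso S \<Longrightarrow> pair_ring S"
  by (simp add: partial_iso_def)

lemma partial_iso_zero: "partial_iso S \<Longrightarrow> (a, b) \<in> S \<Longrightarrow> a = 0 \<longleftrightarrow> b = 0"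
  by (auto simp: partial_iso_def)

lemma partial_iso_eq_iff:
  assumes "partial_iso S" "(a, b) \<in> S" "(a', b') \<in> S"
  shows "a = a' \<longleftrightarrow> b = b'"
  using partial_iso_zero[OF assms(1) pair_ring_diff[OF partial_iso_ring[OF assms(1)] assms(2,3)]]
  by simp

lemma partial_iso_converse: "partial_iso S \<Longrightarrow> partial_iso (S\<inverse>)"
  by (auto simp: partial_iso_def pair_ring_def)

inductive_set pair_gen :: "('a::comm_ring_1 \<times> 'b::comm_ring_1) set \<Rightarrow> ('a \<times> 'b) set"
  for A where
  base: "(a, b) \<in> A \<Longrightarrow> (a, b) \<in> pair_gen A"
| one: "(1, 1) \<in> pair_gen A"
| diff: "(a, b) \<in> pair_gen A \<Longrightarrow> (c, d) \<in> pair_gen A \<Longrightarrow> (a - c, b - d) \<in> pair_gen A"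
| mult: "(a, b) \<in> pair_gen A \<Longrightarrow> (c, d) \<in> pair_gen A \<Longrightarrow> (a * c, b * d) \<in> pair_gen A"

lemma pair_ring_pair_gen: "pair_ring (pair_gen A)"
  by (auto simp: pair_ring_def intro: pair_gen.intros)

lemma pair_gen_subset:
  assumes "pair_ring S" "A \<subseteq> S" shows "pair_gen A \<subseteq> S"
proof (rule subrelI)
  fix a b assume "(a, b) \<in> pair_gen A"
  then show "(a, b) \<in> S"
    by induction (use assms in \<open>auto intro: pair_ring_1 pair_ring_diff pair_ring_mult\<close>)
qed

lemma pair_gen_Id:
  assumes "(a, b) \<in> pair_gen A" "A \<subseteq> Id" shows "a = b"
  using assms by induction auto

text \<open>The first component is an integer polynomial expression in the \<open>f e\<close>; the
  same expression in the \<open>h e\<close> supplies \<open>b'\<close>.\<close>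

lemma pair_gen_change_snd:
  assumes "(a, b) \<in> pair_gen ((\<lambda>e. (f e, g e)) ` K)"
  shows "\<exists>b'. (a, b') \<in> pair_gen ((\<lambda>e. (f e, h e)) ` K)"
  using assms
proof induction
  case (base a b)
  then show ?case by (auto intro!: pair_gen.base)
qed (blast intro: pair_gen.intros)+

section \<open>Polynomials over a ring of pairs\<close>

definition poly_pairs :: "('a::comm_ring_1 \<times> 'b::comm_ring_1) set \<Rightarrow> ('a poly \<times> 'b poly) set" where
  "poly_pairs S = {(f, g). \<forall>i. (coeff f i, coeff g i) \<in> S}"

lemma poly_pairs_coeff: "(f, g) \<in> poly_pairs S \<Longrightarrow> (coeff f i, coeff g i) \<in> S"
  by (simp add: poly_pairs_def)

lemma pair_ring_poly_pairs:
  assumes "pair_ring S" shows "pair_ring (poly_pairs S)"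
  unfolding pair_ring_def poly_pairs_def
  by (auto simp: coeff_mult coeff_1 intro!: pair_ring_sum pair_ring_mult pair_ring_diff assms
      pair_ring_0 pair_ring_1)

lemma monom_poly_pairs:
  assumes "pair_ring S" "(a, b) \<in> S" shows "(monom a n, monom b n) \<in> poly_pairs S"
  using assms by (auto simp: poly_pairs_def pair_ring_0)

lemma smult_poly_pairs:
  assumes "pair_ring S" "(a, b) \<in> S" "(f, g) \<in> poly_pairs S"
  shows "(smult a f, smult b g) \<in> poly_pairs S"
  using assms by (auto simp: poly_pairs_def intro: pair_ring_mult)

lemma pair_ring_poly:
  assumes "pair_ring S" "(f, f) \<in> poly_pairs S" "(a, b) \<in> S"
  shows "(poly f a, poly f b) \<in> S"
  unfolding poly_altdef
  by (intro pair_ring_sum pair_ring_mult pair_ring_power poly_pairs_coeff assms)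

lemma poly_pairs_zero:
  assumes "partial_iso S" "(f, g) \<in> poly_pairs S"
  shows "f = 0 \<longleftrightarrow> g = 0"
  using partial_iso_zero[OF assms(1) poly_pairs_coeff[OF assms(2)]] by (simp add: poly_eq_iff)

lemma poly_pairs_degree:
  assumes "partial_iso S" "(f, g) \<in> poly_pairs S"
  shows "degree f = degree g"
  using partial_iso_zero[OF assms(1) poly_pairs_coeff[OF assms(2)]] unfolding degree_def by simp

lemma poly_pairs_converse: "(f, g) \<in> poly_pairs S \<longleftrightarrow> (g, f) \<in> poly_pairs (S\<inverse>)"
  by (simp add: poly_pairs_def)

text \<open>Long division without inverses: each step multiplies by the leading coefficient of the
  divisor. Leading coefficients are paired in \<open>S\<close>, so the same steps run on both
  components.\<close>

lemma poly_pairs_pseudo_div: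
  fixes S :: "('a::idom \<times> 'b::idom) set"
  assumes S: "partial_iso S" and fg: "(f, g) \<in> poly_pairs S" "f \<noteq> 0"
    and hk: "(h, k) \<in> poly_pairs S"
  shows "\<exists>l l' q q' r r'. (l, l') \<in> S \<and> l \<noteq> 0 \<and> (q, q') \<in> poly_pairs S \<and> (r, r') \<in> poly_pairs S \<and>
    smult l h = f * q + r \<and> smult l' k = g * q' + r' \<and> (r = 0 \<or> degree r < degree f)"
  using hk
\<comment> \<open>The shift by \<open>Suc\<close> separates nonzero constants from the zero
  polynomial, so cancelling a constant also decreases the measure.\<close>
proof (induction "if h = 0 then 0 else Suc (degree h)" arbitrary: h k rule: less_induct)
  case less
  note R = partial_iso_ring[OF S]
  note RP = pair_ring_poly_pairs[OF R]
  show ?case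
  proof (cases "h = 0 \<or> degree h < degree f")
    case True
    have "smult 1 h = f * 0 + h" "smult 1 k = g * 0 + k" by auto
    then show ?thesis using True less.prems pair_ring_1[OF R] pair_ring_0[OF RP]
      by (metis zero_neq_one)
  next
    case False
    define n where "n = degree h - degree f"
    define m m' where "m = monom (lead_coeff h) n" and "m' = monom (lead_coeff k) n"
    define h1 k1 where "h1 = smult (lead_coeff f) h - m * f"
      and "k1 = smult (lead_coeff g) k - m' * g"
    have dg: "degree g = degree f" "degree k = degree h"
      using poly_pairs_degree[OF S fg(1)] poly_pairs_degree[OF S less.prems] by auto
    have lf: "(lead_coeff f, lead_coeff g) \<in> S" and lh: "(lead_coeff h, lead_coeff k) \<in> S"
      using poly_pairs_coeff[OF fg(1)] poly_pairs_coeff[OF less.prems] dg by simp_all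
    have m: "(m, m') \<in> poly_pairs S"
      unfolding m_def m'_def by (rule monom_poly_pairs[OF R lh])
    have h1: "(h1, k1) \<in> poly_pairs S"
      unfolding h1_def k1_def
      by (intro pair_ring_diff[OF RP] smult_poly_pairs[OF R lf] less.prems pair_ring_mult[OF RP] m fg)
    have deg: "h1 = 0 \<or> degree h1 < degree h"
    \<comment> \<open>For constant \<open>h\<close> the degree has no room to drop; there
      \<open>h1\<close> vanishes outright.\<close>
    proof (cases "degree h = 0")
      case True
      then obtain a b where "h = [:a:]" "f = [:b:]"
        using False by (metis degree_eq_zeroE not_gr_zero)
      then show ?thesis by (simp add: h1_def m_def n_def monom_0)
    next
      case h: False
      have c: "coeff h1 (degree h) = 0"
        using False by (simp add: h1_def m_def n_def coeff_monom_mult)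
      have "degree (m * f) \<le> degree h"
        using False degree_mult_le[of m f] degree_monom_le[of "lead_coeff h" n]
        unfolding m_def n_def by linarith
      then have "degree h1 \<le> degree h" unfolding h1_def
        by (intro degree_diff_le) auto
      then show ?thesis using c h by (metis leading_coeff_0_iff le_neq_implies_less)
    qed
    have "(if h1 = 0 then 0 else Suc (degree h1)) < (if h = 0 then 0 else Suc (degree h))"
      using deg False by auto
    from less.hyps[OF this h1] obtain l l' q q' r r' where
      IH: "(l, l') \<in> S" "l \<noteq> 0" "(q, q') \<in> poly_pairs S" "(r, r') \<in> poly_pairs S"
      "smult l h1 = f * q + r" "smult l' k1 = g * q' + r'" "r = 0 \<or> degree r < degree f" by blast
    have 1: "smult (l * lead_coeff f) h = f * (q + smult l m) + r"
    proof -
      have "smult (l * lead_coeff f) h = smult l h1 + smult l (m * f)"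
        by (simp add: h1_def smult_diff_right)
      then show ?thesis by (simp add: IH algebra_simps)
    qed
    have 2: "smult (l' * lead_coeff g) k = g * (q' + smult l' m') + r'"
    proof -
      have "smult (l' * lead_coeff g) k = smult l' k1 + smult l' (m' * g)"
        by (simp add: k1_def smult_diff_right)
      then show ?thesis by (simp add: IH algebra_simps)
    qed
    have "(l * lead_coeff f, l' * lead_coeff g) \<in> S" "l * lead_coeff f \<noteq> 0"
      using IH fg by (auto intro: pair_ring_mult[OF R] lf)
    moreover have "(q + smult l m, q' + smult l' m') \<in> poly_pairs S"
      by (intro pair_ring_add[OF RP] IH smult_poly_pairs[OF R] m)
    ultimately show ?thesis using 1 2 IH(4,7) by blast
  qed
qed

text \<open>For a pair ring \<open>S\<close> this extends the relation by sending \<open>c\<close>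
  to \<open>d\<close>; for arbitrary \<open>c\<close> and \<open>d\<close> the result may be neither
  single-valued nor injective.\<close>

definition adjoin :: "('a::comm_ring_1 \<times> 'b::comm_ring_1) set \<Rightarrow> 'a \<Rightarrow> 'b \<Rightarrow> ('a \<times> 'b) set" where
  "adjoin S c d = (\<lambda>(f, g). (poly f c, poly g d)) ` poly_pairs S"

lemma pair_ring_adjoin:
  assumes "pair_ring S" shows "pair_ring (adjoin S c d)"
proof -
  note RP = pair_ring_poly_pairs[OF assms]
  have "(poly 1 c, poly 1 d) \<in> adjoin S c d"
    unfolding adjoin_def using pair_ring_1[OF RP] by force
  moreover have "(poly f c - poly f' c, poly g d - poly g' d) \<in> adjoin S c d \<and>
      (poly f c * poly f' c, poly g d * poly g' d) \<in> adjoin S c d"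
    if "(f, g) \<in> poly_pairs S" "(f', g') \<in> poly_pairs S" for f g f' g'
    unfolding adjoin_def using pair_ring_diff[OF RP that] pair_ring_mult[OF RP that]
    by (force simp flip: poly_diff poly_mult)
  ultimately show ?thesis unfolding pair_ring_def by (auto simp: adjoin_def)
qed

lemma adjoin_supset:
  assumes "pair_ring S" shows "S \<subseteq> adjoin S c d" "(c, d) \<in> adjoin S c d"
proof -
  have "(poly (monom a 0) c, poly (monom b 0) d) \<in> adjoin S c d" if "(a, b) \<in> S" for a b
    unfolding adjoin_def using monom_poly_pairs[OF assms that] by force
  then show "S \<subseteq> adjoin S c d" by (auto simp: poly_monom)
  have "(poly (monom 1 1) c, poly (monom 1 1) d) \<in> adjoin S c d"
    unfolding adjoin_def using monom_poly_pairs[OF assms pair_ring_1[OF assms]] by force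
  then show "(c, d) \<in> adjoin S c d" by (simp add: poly_monom)
qed

lemma countable_poly_pairs:
  assumes "countable S" shows "countable (poly_pairs S)"
proof -
  have "poly_pairs S \<subseteq> (\<lambda>l. (Poly (map fst l), Poly (map snd l))) ` lists S"
  proof (rule subrelI)
    fix f g assume fg: "(f, g) \<in> poly_pairs S"
    define l where "l = map (\<lambda>i. (coeff f i, coeff g i)) [0..<Suc (max (degree f) (degree g))]"
    have "f = Poly (map fst l)" "g = Poly (map snd l)"
      by (auto simp: l_def poly_eq_iff nth_default_def coeff_eq_0 simp del: upt_Suc)
    moreover have "l \<in> lists S" using fg by (auto simp: l_def poly_pairs_def)
    ultimately show "(f, g) \<in> (\<lambda>l. (Poly (map fst l), Poly (map snd l))) ` lists S" by blast
  qed
  then show ?thesis by (rule countable_subset) (use assms in blast)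
qed

lemma countable_adjoin: "countable S \<Longrightarrow> countable (adjoin S c d)"
  unfolding adjoin_def using countable_poly_pairs by blast

text \<open>Starting from the image of the integers, generators are adjoined one at a time, and each
  adjunction preserves countability. This later leaves room to avoid algebraic values.\<close>

lemma countable_pair_gen:
  fixes A :: "('a::comm_ring_1 \<times> 'b::comm_ring_1) set"
  assumes "finite A" shows "countable (pair_gen A)"
  using assms
proof induction
  case empty
  have "pair_gen {} \<subseteq> (range (\<lambda>k. (of_int k, of_int k)) :: ('a \<times> 'b) set)"
  proof (rule pair_gen_subset)
    show "pair_ring (range (\<lambda>k. (of_int k, of_int k)) :: ('a \<times> 'b) set)"
      unfolding pair_ring_def
      by (auto simp: image_iff simp flip: of_int_diff of_int_mult intro: exI[of _ "1::int"])
  qed simp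
  then show ?case by (rule countable_subset) simp
next
  case (insert x A)
  obtain c d where x: "x = (c, d)" by (cases x)
  have "pair_gen (insert x A) \<subseteq> adjoin (pair_gen A) c d"
  proof (rule pair_gen_subset)
    show "pair_ring (adjoin (pair_gen A) c d)" by (intro pair_ring_adjoin pair_ring_pair_gen)
    show "insert x A \<subseteq> adjoin (pair_gen A) c d"
      unfolding x using adjoin_supset[OF pair_ring_pair_gen[of A], of c d] by (auto intro: pair_gen.base)
  qed
  then show ?case by (rule countable_subset) (rule countable_adjoin[OF insert.IH])
qed

lemma partial_iso_adjoin:
  assumes "partial_iso S"
    and "\<And>f g. (f, g) \<in> poly_pairs S \<Longrightarrow> poly f c = 0 \<longleftrightarrow> poly g d = 0"
  shows "partial_iso (adjoin S c d)"
  using assms pair_ring_adjoin unfolding partial_iso_def adjoin_def by fastforce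

text \<open>Without algebraic relations on either side, an evaluation vanishes only when the
  polynomial is zero, and paired polynomials are zero together.\<close>

lemma partial_iso_adjoin_transcendental:
  assumes S: "partial_iso S"
    and "\<And>f g. (f, g) \<in> poly_pairs S \<Longrightarrow> poly f c = 0 \<Longrightarrow> f = 0"
    and "\<And>f g. (f, g) \<in> poly_pairs S \<Longrightarrow> poly g d = 0 \<Longrightarrow> g = 0"
  shows "partial_iso (adjoin S c d)"
proof (rule partial_iso_adjoin[OF S])
  fix f g assume fg: "(f, g) \<in> poly_pairs S"
  show "poly f c = 0 \<longleftrightarrow> poly g d = 0"
    using assms(2,3)[OF fg] poly_pairs_zero[OF S fg] by auto
qed

section \<open>Extending partial isomorphisms inside the complex numbers\<close>

definition minimal_poly_pair ::
    "('a::idom \<times> 'b::idom) set \<Rightarrow> 'a \<Rightarrow> 'a poly \<Rightarrow> 'b poly \<Rightarrow> bool" where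
  "minimal_poly_pair S c f g \<longleftrightarrow> (f, g) \<in> poly_pairs S \<and> f \<noteq> 0 \<and> poly f c = 0 \<and>
     (\<forall>h k. (h, k) \<in> poly_pairs S \<longrightarrow> poly h c = 0 \<longrightarrow> degree h < degree f \<longrightarrow> h = 0)"

lemma ex_minimal_poly_pair:
  assumes "(f0, g0) \<in> poly_pairs S" "f0 \<noteq> 0" "poly f0 c = 0"
  shows "\<exists>f g. minimal_poly_pair S c f g"
proof -
  define P where "P = (\<lambda>(f, g). (f, g) \<in> poly_pairs S \<and> f \<noteq> 0 \<and> poly f c = 0)"
  have "P (f0, g0)" using assms by (simp add: P_def)
  then obtain x where x: "P x" "\<And>y. P y \<Longrightarrow> degree (fst x) \<le> degree (fst y)"
    using ex_has_least_nat[of P _ "\<lambda>x. degree (fst x)"] by blast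
  obtain f g where fg: "x = (f, g)" by (cases x)
  have "degree f \<le> degree h" if "(h, k) \<in> poly_pairs S" "h \<noteq> 0" "poly h c = 0" for h k
    using x(2)[of "(h, k)"] that by (simp add: P_def fg)
  then show ?thesis using x(1) unfolding P_def fg minimal_poly_pair_def by (auto simp: not_less[symmetric])
qed

lemma minimal_poly_pair_degree: "minimal_poly_pair S c f g \<Longrightarrow> degree f \<noteq> 0"
  by (rule notI, erule degree_eq_zeroE) (auto simp: minimal_poly_pair_def)

text \<open>The pseudo-remainder of \<open>h\<close> by \<open>f\<close> vanishes at
  \<open>c\<close> and has smaller degree than \<open>f\<close>, so minimality makes it zero; its
  partner is then zero as well.\<close>

lemma minimal_poly_pair_dvd:
  assumes S: "partial_iso S" and min: "minimal_poly_pair S c f g"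
    and hk: "(h, k) \<in> poly_pairs S" "poly h c = 0"
  shows "\<exists>l l' q q'. l \<noteq> 0 \<and> l' \<noteq> 0 \<and> (q, q') \<in> poly_pairs S \<and>
    smult l h = f * q \<and> smult l' k = g * q'"
proof -
  have fg: "(f, g) \<in> poly_pairs S" "f \<noteq> 0" "poly f c = 0"
    using min by (auto simp: minimal_poly_pair_def)
  obtain l l' q q' r r' where *: "(l, l') \<in> S" "l \<noteq> 0" "(q, q') \<in> poly_pairs S"
    "(r, r') \<in> poly_pairs S" "smult l h = f * q + r" "smult l' k = g * q' + r'"
    "r = 0 \<or> degree r < degree f"
    using poly_pairs_pseudo_div[OF S fg(1,2) hk(1)] by blast
  have "poly (smult l h) c = poly (f * q + r) c" using * by simp
  then have "poly r c = 0" using hk fg by simp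
  then have "r = 0" using min *(4,7) unfolding minimal_poly_pair_def by blast
  then have "r' = 0" using poly_pairs_zero[OF S *(4)] by simp
  then show ?thesis using * \<open>r = 0\<close> partial_iso_zero[OF S *(1)]
    by (intro exI[of _ l] exI[of _ l'] exI[of _ q] exI[of _ q']) auto
qed

text \<open>If \<open>c\<close> is transcendental over the domain of \<open>S\<close>, countability
  leaves a \<open>d\<close> transcendental over the range. Otherwise \<open>d\<close> is a root of
  the partner \<open>g\<close> of a minimal polynomial of \<open>c\<close>, by algebraic
  closedness.\<close>

lemma ex_partial_iso_extension:
  fixes S :: "(complex \<times> complex) set"
  assumes S: "partial_iso S" and "countable S"
  shows "\<exists>d. partial_iso (adjoin S c d)"
proof (cases "\<exists>f g. (f, g) \<in> poly_pairs S \<and> f \<noteq> 0 \<and> poly f c = 0")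
  case False
  have "countable (\<Union>(f, g)\<in>poly_pairs S - {(0, 0)}. {z. poly g z = 0})" (is "countable ?B")
    using poly_pairs_zero[OF S]
    by (intro countable_UN countable_Diff countable_poly_pairs assms)
      (auto intro!: countable_finite poly_roots_finite)
  then obtain d where "d \<notin> ?B" using uncountable_UNIV_complex
    by (metis UNIV_eq_I)
  then have "partial_iso (adjoin S c d)"
    using False by (intro partial_iso_adjoin_transcendental[OF S]) auto
  then show ?thesis by blast
next
  case True
  then obtain f g where min: "minimal_poly_pair S c f g"
    using ex_minimal_poly_pair by blast
  then have fg: "(f, g) \<in> poly_pairs S" "f \<noteq> 0" "poly f c = 0"
    by (auto simp: minimal_poly_pair_def)
  have g0: "g \<noteq> 0" using poly_pairs_zero[OF S fg(1)] fg by simp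
  have "degree g = degree f" using poly_pairs_degree[OF S fg(1)] by simp
  then obtain d where d: "poly g d = 0"
    using minimal_poly_pair_degree[OF min] alg_closed_imp_poly_has_root[of g] by (metis gr0I)
  have S': "partial_iso (S\<inverse>)" by (rule partial_iso_converse[OF S])
  have gf: "(g, f) \<in> poly_pairs (S\<inverse>)" using fg(1) poly_pairs_converse by blast
  \<comment> \<open>To reflect vanishing from \<open>d\<close> back to \<open>c\<close>, a minimal
    pair at \<open>d\<close> is needed, and its partner \<open>f1\<close> must vanish at
    \<open>c\<close>. Up to a nonzero factor \<open>f\<close> is \<open>f1 * q'\<close>; as
    \<open>f1\<close> is not constant, \<open>q'\<close> has smaller degree than \<open>f\<close>,
    so by minimality \<open>c\<close> is a root of \<open>f1\<close> rather than of
    \<open>q'\<close>.\<close>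
  obtain g1 f1 where min1: "minimal_poly_pair (S\<inverse>) d g1 f1"
    using ex_minimal_poly_pair[OF gf g0 d] by blast
  then have f1: "(f1, g1) \<in> poly_pairs S"
    using poly_pairs_converse unfolding minimal_poly_pair_def by blast
  have degf1: "degree f1 \<noteq> 0"
    using minimal_poly_pair_degree[OF min1] poly_pairs_degree[OF S f1] by simp
  obtain l l' q q' where q: "l' \<noteq> 0" "(q, q') \<in> poly_pairs (S\<inverse>)" "smult l' f = f1 * q'"
    using minimal_poly_pair_dvd[OF S' min1 gf d] by blast
  have nz: "f1 \<noteq> 0" "q' \<noteq> 0" using q fg by auto
  have "degree f = degree f1 + degree q'"
    using arg_cong[OF q(3), of degree] q(1) nz by (simp add: degree_mult_eq)
  moreover have "(q', q) \<in> poly_pairs S" using q(2) poly_pairs_converse by blast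
  ultimately have "poly q' c \<noteq> 0"
    using min nz degf1 unfolding minimal_poly_pair_def by (metis add.commute less_add_same_cancel1 neq0_conv)
  moreover have "poly (smult l' f) c = poly (f1 * q') c" using q by simp
  ultimately have f1c: "poly f1 c = 0" using fg by simp
  have "poly f' c = 0 \<longleftrightarrow> poly g' d = 0" if fg': "(f', g') \<in> poly_pairs S" for f' g'
  proof
    assume "poly f' c = 0"
    then obtain l' q' where "l' \<noteq> 0" "smult l' g' = g * q'"
      using minimal_poly_pair_dvd[OF S min fg'] by blast
    then have "l' * poly g' d = 0" using d by (metis poly_smult poly_mult mult_zero_left)
    then show "poly g' d = 0" using \<open>l' \<noteq> 0\<close> by simp
  next
    assume "poly g' d = 0"
    moreover have "(g', f') \<in> poly_pairs (S\<inverse>)" using fg' poly_pairs_converse by blast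
    ultimately obtain l' q' where "l' \<noteq> 0" "smult l' f' = f1 * q'"
      using minimal_poly_pair_dvd[OF S' min1] by blast
    then have "l' * poly f' c = 0" using f1c by (metis poly_smult poly_mult mult_zero_left)
    then show "poly f' c = 0" using \<open>l' \<noteq> 0\<close> by simp
  qed
  then have "partial_iso (adjoin S c d)" by (rule partial_iso_adjoin[OF S])
  then show ?thesis by blast
qed

lemma partial_iso_extend_finite:
  fixes S :: "(complex \<times> complex) set"
  assumes "partial_iso S" "countable S" "finite C"
  shows "\<exists>T. S \<subseteq> T \<and> partial_iso T \<and> C \<subseteq> Domain T"
proof -
  \<comment> \<open>Countability is carried through the induction because the next one-element
    extension requires it.\<close>
  have "\<exists>T. S \<subseteq> T \<and> partial_iso T \<and> countable T \<and> C \<subseteq> Domain T"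
    using assms(3)
  proof induction
    case empty
    then show ?case using assms by blast
  next
    case (insert c C)
    then obtain T where T: "S \<subseteq> T" "partial_iso T" "countable T" "C \<subseteq> Domain T" by blast
    obtain d where d: "partial_iso (adjoin T c d)" using ex_partial_iso_extension T by blast
    have "T \<subseteq> adjoin T c d" "(c, d) \<in> adjoin T c d"
      using adjoin_supset partial_iso_ring[OF T(2)] by blast+
    then show ?case using d T countable_adjoin[OF T(3)]
      by (intro exI[of _ "adjoin T c d"]) (auto simp: Domain_iff, blast)
  qed
  then show ?thesis by blast
qed

section \<open>Polynomial functions with rational coefficients\<close>

text \<open>Terms form a list that may repeat monomials, so that addition is concatenation; like
  terms are collected only when \<open>alg_indep_rat\<close> is applied.\<close>

definition rat_poly_value :: "'i set \<Rightarrow> (rat \<times> ('i \<Rightarrow> nat)) list \<Rightarrow> ('i \<Rightarrow> complex) \<Rightarrow> complex" where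
  "rat_poly_value I L x = (\<Sum>(a, m)\<leftarrow>L. of_rat a * (\<Prod>i\<in>I. x i ^ m i))"

definition rat_poly_funs :: "'i set \<Rightarrow> (('i \<Rightarrow> complex) \<Rightarrow> complex) set" where
  "rat_poly_funs I = {rat_poly_value I L | L. \<forall>(a, m)\<in>set L. \<forall>i. i \<notin> I \<longrightarrow> m i = 0}"

lemma rat_poly_funs_const: "(\<lambda>_. of_rat r) \<in> rat_poly_funs I"
proof -
  have "(\<lambda>_. of_rat r) = rat_poly_value I [(r, \<lambda>_. 0)]" by (simp add: rat_poly_value_def fun_eq_iff)
  then show ?thesis unfolding rat_poly_funs_def by force
qed

lemma rat_poly_funs_var:
  assumes "finite I" "j \<in> I" shows "(\<lambda>x. x j) \<in> rat_poly_funs I"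
proof -
  have "(\<Prod>i\<in>I. x i ^ (if i = j then 1 else 0)) = x j" for x :: "'a \<Rightarrow> complex"
  proof -
    have "(\<Prod>i\<in>I. x i ^ (if i = j then 1 else 0)) = (\<Prod>i\<in>I. if i = j then x i else 1)"
      by (intro prod.cong) auto
    then show ?thesis using assms by simp
  qed
  then have "(\<lambda>x. x j) = rat_poly_value I [(1, \<lambda>i. if i = j then 1 else 0)]"
    by (simp add: rat_poly_value_def fun_eq_iff)
  then show ?thesis using assms unfolding rat_poly_funs_def by force
qed

lemma rat_poly_funs_add:
  assumes "F \<in> rat_poly_funs I" "G \<in> rat_poly_funs I"
  shows "(\<lambda>x. F x + G x) \<in> rat_poly_funs I"
proof -
  obtain L M where "F = rat_poly_value I L" "\<forall>(a, m)\<in>set L. \<forall>i. i \<notin> I \<longrightarrow> m i = 0"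
    "G = rat_poly_value I M" "\<forall>(a, m)\<in>set M. \<forall>i. i \<notin> I \<longrightarrow> m i = 0"
    using assms by (auto simp: rat_poly_funs_def)
  then have "(\<lambda>x. F x + G x) = rat_poly_value I (L @ M) \<and>
      (\<forall>(a, m)\<in>set (L @ M). \<forall>i. i \<notin> I \<longrightarrow> m i = 0)"
    by (auto simp: rat_poly_value_def fun_eq_iff)
  then show ?thesis unfolding rat_poly_funs_def by blast
qed

lemma rat_poly_funs_mult:
  assumes "F \<in> rat_poly_funs I" "G \<in> rat_poly_funs I"
  shows "(\<lambda>x. F x * G x) \<in> rat_poly_funs I"
proof -
  obtain M where M: "G = rat_poly_value I M" "\<forall>(a, m)\<in>set M. \<forall>i. i \<notin> I \<longrightarrow> m i = 0"
    using assms by (auto simp: rat_poly_funs_def)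
  have "(\<lambda>x. rat_poly_value I L x * G x) \<in> rat_poly_funs I"
    if "\<forall>(a, m)\<in>set L. \<forall>i. i \<notin> I \<longrightarrow> m i = 0" for L
    using that
  proof (induction L)
    case Nil
    then show ?case using rat_poly_funs_const[of 0 I] by (simp add: rat_poly_value_def)
  next
    case (Cons t L)
    obtain a m where t: "t = (a, m)" by (cases t)
    define K where "K = map (\<lambda>(b, n). (a * b, \<lambda>i. m i + n i)) M"
    have "rat_poly_value I K x = of_rat a * (\<Prod>i\<in>I. x i ^ m i) * G x" for x
      unfolding K_def M(1) rat_poly_value_def
      by (induction M) (auto simp: of_rat_mult power_add prod.distrib algebra_simps)
    moreover have "\<forall>(a, m)\<in>set K. \<forall>i. i \<notin> I \<longrightarrow> m i = 0"
      using M(2) Cons.prems by (auto simp: K_def t)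
    ultimately have "(\<lambda>x. of_rat a * (\<Prod>i\<in>I. x i ^ m i) * G x) \<in> rat_poly_funs I"
      unfolding rat_poly_funs_def by (auto simp: fun_eq_iff intro!: exI[of _ K])
    from rat_poly_funs_add[OF this Cons.IH] Cons.prems show ?case
      by (simp add: t rat_poly_value_def algebra_simps)
  qed
  then show ?thesis using assms(1) by (auto simp: rat_poly_funs_def)
qed

lemma rat_poly_funs_diff:
  assumes "F \<in> rat_poly_funs I" "G \<in> rat_poly_funs I"
  shows "(\<lambda>x. F x - G x) \<in> rat_poly_funs I"
  using rat_poly_funs_add[OF assms(1) rat_poly_funs_mult[OF rat_poly_funs_const[of "-1"] assms(2)]]
  by (simp add: of_rat_minus)

lemma rat_poly_funs_sum:
  assumes "\<And>k. k \<in> K \<Longrightarrow> F k \<in> rat_poly_funs I"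
  shows "(\<lambda>x. \<Sum>k\<in>K. F k x) \<in> rat_poly_funs I"
  using assms rat_poly_funs_const[of 0 I]
  by (induction K rule: infinite_finite_induct) (auto intro: rat_poly_funs_add)

lemma rat_poly_funs_prod:
  assumes "\<And>k. k \<in> K \<Longrightarrow> F k \<in> rat_poly_funs I"
  shows "(\<lambda>x. \<Prod>k\<in>K. F k x) \<in> rat_poly_funs I"
  using assms rat_poly_funs_const[of 1 I]
  by (induction K rule: infinite_finite_induct) (auto intro: rat_poly_funs_mult)

lemma rat_poly_funs_det:
  fixes F :: "'n::finite \<Rightarrow> 'n \<Rightarrow> ('i \<Rightarrow> complex) \<Rightarrow> complex"
  assumes "\<And>i j. F i j \<in> rat_poly_funs I"
  shows "(\<lambda>x. det (\<chi> i j. F i j x)) \<in> rat_poly_funs I"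
  unfolding det_def
  using rat_poly_funs_const[of "of_int (sign _)" I] assms
  by (auto intro!: rat_poly_funs_sum rat_poly_funs_mult rat_poly_funs_prod)

text \<open>Collecting like terms yields a coefficient map as in \<open>alg_indep_rat\<close>.
  \<open>M\<close> may exceed the monomials of \<open>L\<close>, which keeps it fixed during the
  induction on \<open>L\<close>.\<close>

lemma rat_poly_value_collect:
  assumes "finite M" "snd ` set L \<subseteq> M"
  shows "rat_poly_value I L x =
    (\<Sum>m\<in>M. of_rat (\<Sum>(a, n)\<leftarrow>L. if n = m then a else 0) * (\<Prod>i\<in>I. x i ^ m i))"
  using assms(2)
proof (induction L)
  case Nil
  then show ?case by (simp add: rat_poly_value_def)
next
  case (Cons t L)
  obtain a n where t: "t = (a, n)" by (cases t)
  have "(\<Sum>m\<in>M. of_rat (if n = m then a else 0) * (\<Prod>i\<in>I. x i ^ m i)) =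
      (\<Sum>m\<in>M. if n = m then of_rat a * (\<Prod>i\<in>I. x i ^ m i) else 0)"
    by (intro sum.cong) auto
  also have "\<dots> = of_rat a * (\<Prod>i\<in>I. x i ^ n i)"
    using assms(1) Cons.prems by (simp add: t)
  finally show ?case using Cons
    by (simp add: t rat_poly_value_def of_rat_add ring_distribs sum.distrib)
qed

text \<open>After like terms are collected, algebraic independence makes every coefficient zero, so
  \<open>F\<close> is the zero function. This carries identities from a generic point to all
  others.\<close>

lemma alg_indep_rat_poly_fun_zero:
  assumes x: "alg_indep_rat x I" and F: "F \<in> rat_poly_funs I" and 0: "F x = 0"
  shows "F y = 0"
proof -
  obtain L where L: "F = rat_poly_value I L" "\<forall>(a, m)\<in>set L. \<forall>i. i \<notin> I \<longrightarrow> m i = 0"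
    using F by (auto simp: rat_poly_funs_def)
  define c where "c = (\<lambda>m. \<Sum>(a, n)\<leftarrow>L. if n = m then a else 0)"
  have nz: "m \<in> snd ` set L" if "c m \<noteq> 0" for m
  proof (rule ccontr)
    assume "m \<notin> snd ` set L"
    then have "c m = 0" unfolding c_def by (induction L) auto
    then show False using that by simp
  qed
  have fin: "finite {m. c m \<noteq> 0}" by (rule finite_subset[of _ "snd ` set L"]) (use nz in auto)
  have val: "F z = (\<Sum>m\<in>snd ` set L. of_rat (c m) * (\<Prod>i\<in>I. z i ^ m i))" for z
    unfolding L(1) c_def by (rule rat_poly_value_collect) auto
  also have "\<dots> x = (\<Sum>m\<in>{m. c m \<noteq> 0}. of_rat (c m) * (\<Prod>i\<in>I. x i ^ m i))"
    by (rule sum.mono_neutral_right) (use nz in auto)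
  finally have "(\<Sum>m\<in>{m. c m \<noteq> 0}. of_rat (c m) * (\<Prod>i\<in>I. x i ^ m i)) = 0"
    using 0 by simp
  moreover have "\<forall>m. c m \<noteq> 0 \<longrightarrow> (\<forall>i. i \<notin> I \<longrightarrow> m i = 0)"
    using nz L(2) by fastforce
  ultimately have "\<forall>m. c m = 0"
    using x fin unfolding alg_indep_rat_def by blast
  then show ?thesis by (simp add: val)
qed

section \<open>Squared distances and congruence\<close>

definition cdot :: "complex ^ 'n \<Rightarrow> complex ^ 'n \<Rightarrow> complex" where
  "cdot x y = (\<Sum>i\<in>UNIV. x $ i * y $ i)"

lemma sqform_cdot: "sqform x = cdot x x"
  by (simp add: sqform_def cdot_def power2_eq_square)

lemma cdot_matrix_vector: "cdot (A *v x) y = cdot x (transpose A *v y)"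
  unfolding cdot_def matrix_vector_mult_def transpose_def
  by (simp add: sum_distrib_left sum_distrib_right, subst sum.swap) (simp add: mult_ac)

lemma cdot_polarisation: "sqform x + sqform y - sqform (x - y) = 2 * cdot x y"
  unfolding sqform_def cdot_def sum_distrib_left sum.distrib[symmetric] sum_subtractf[symmetric]
  by (intro sum.cong) (auto simp: power2_eq_square algebra_simps)

definition sqdist :: "('v \<Rightarrow> complex ^ 'n) \<Rightarrow> 'v \<times> 'v \<Rightarrow> complex" where
  "sqdist p = (\<lambda>(v, w). sqform (p v - p w))"

lemma congruent_imp_sqdist_eq:
  assumes "congruent V p q" "v \<in> V" "w \<in> V"
  shows "sqdist p (v, w) = sqdist q (v, w)"
proof -
  obtain A b where A: "transpose A ** A = mat 1" and q: "\<forall>v\<in>V. q v = A *v p v + b"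
    using assms(1) by (auto simp: congruent_def)
  have "q v - q w = A *v (p v - p w)"
    using q assms by (simp add: matrix_vector_mult_diff_distrib)
  then have "sqform (q v - q w) = cdot (p v - p w) ((transpose A ** A) *v (p v - p w))"
    by (simp add: sqform_cdot cdot_matrix_vector matrix_vector_mul_assoc)
  then show ?thesis by (simp add: A sqdist_def sqform_cdot)
qed

text \<open>Invertible exactly when \<open>p u\<close> and the points \<open>p (f i)\<close>
  affinely span the space.\<close>

definition edge_matrix :: "('v \<Rightarrow> complex ^ 'n) \<Rightarrow> 'v \<Rightarrow> ('n \<Rightarrow> 'v) \<Rightarrow> complex ^ 'n ^ 'n" where
  "edge_matrix p u f = (\<chi> i. p (f i) - p u)"

text \<open>Twice the Gram matrix of the rows of \<open>edge_matrix p u f\<close>, by polarisation.\<close>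
definition gram_matrix :: "('v \<Rightarrow> complex ^ 'n) \<Rightarrow> 'v \<Rightarrow> ('n \<Rightarrow> 'v) \<Rightarrow> complex ^ 'n ^ 'n" where
  "gram_matrix p u f =
     (\<chi> i j. sqdist p (f i, u) + sqdist p (f j, u) - sqdist p (f i, f j))"

lemma sqdist_cdot:
  "sqdist p (v, u) + sqdist p (w, u) - sqdist p (v, w) = 2 * cdot (p v - p u) (p w - p u)"
  using cdot_polarisation[of "p v - p u" "p w - p u"] by (simp add: sqdist_def)

lemma gram_matrix_nth:
  "gram_matrix p u f $ i $ j = 2 * (edge_matrix p u f ** transpose (edge_matrix p u f)) $ i $ j"
  by (simp add: gram_matrix_def sqdist_cdot matrix_matrix_mult_def transpose_def edge_matrix_def cdot_def)

text \<open>With \<open>M\<close> the edge matrix, the left determinant is a power of 2 times the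
  square of \<open>det M\<close>. Nondegeneracy can thus be read off the squared distances.\<close>

lemma det_gram_matrix:
  fixes p :: "'v \<Rightarrow> complex ^ 'n::finite"
  shows "det (gram_matrix p u f) = 0 \<longleftrightarrow> det (edge_matrix p u f) = 0"
proof -
  define M where "M = edge_matrix p u f ** transpose (edge_matrix p u f)"
  have "gram_matrix p u f = (\<chi> i. 2 *s M $ i)"
    by (simp add: vec_eq_iff gram_matrix_nth M_def)
  then have "det (gram_matrix p u f) = (\<Prod>i\<in>(UNIV::'n set). 2) * det (\<chi> i. M $ i)"
    by (simp only: det_rows_mul)
  then show ?thesis by (simp add: M_def det_mul det_transpose)
qed

text \<open>Equal distances give equal Gram matrices, which makes the matrix carrying the rows of
  \<open>M\<close> to those of \<open>N\<close> orthogonal. Every other vertex is determined by its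
  products with the rows of the invertible \<open>M\<close>.\<close>

lemma sqdist_eq_imp_congruent:
  fixes p q :: "'v \<Rightarrow> complex ^ 'n"
  assumes eq: "\<And>v w. v \<in> V \<Longrightarrow> w \<in> V \<Longrightarrow> sqdist p (v, w) = sqdist q (v, w)"
    and u: "u \<in> V" "range f \<subseteq> V" and det: "det (edge_matrix p u f) \<noteq> 0"
  shows "congruent V p q"
proof -
  define M N where "M = edge_matrix p u f" and "N = edge_matrix q u f"
  have cd: "cdot (p v - p u) (p w - p u) = cdot (q v - q u) (q w - q u)"
    if "v \<in> V" "w \<in> V" for v w
    using sqdist_cdot[of p v u w] sqdist_cdot[of q v u w] eq that u by simp
  have MN: "M ** transpose M = N ** transpose N"
    using cd u by (auto simp: M_def N_def vec_eq_iff matrix_matrix_mult_def transpose_def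
        edge_matrix_def cdot_def image_subset_iff)
  obtain M' where M': "M ** M' = mat 1" "M' ** M = mat 1"
    using det unfolding M_def invertible_det_nz[symmetric] invertible_def by blast
  \<comment> \<open>Sending the rows of \<open>M\<close> to those of \<open>N\<close> means
    \<open>N = M ** transpose A\<close>, which forces this choice.\<close>
  define A where "A = transpose (M' ** N)"
  have AT: "transpose A = M' ** N" by (simp add: A_def)
  have "transpose A ** A = M' ** (N ** transpose N) ** transpose M'"
    by (simp add: AT A_def matrix_transpose_mul matrix_mul_assoc)
  also have "\<dots> = (M' ** M) ** transpose (M' ** M)"
    by (simp add: MN[symmetric] matrix_transpose_mul matrix_mul_assoc)
  finally have 1: "transpose A ** A = mat 1" by (simp add: M' transpose_mat)
  then have 2: "A ** transpose A = mat 1" by (simp add: matrix_left_right_inverse)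
  have "q v = A *v p v + (q u - A *v p u)" if "v \<in> V" for v
  proof -
    have "M *v (p v - p u) = N *v (q v - q u)"
      using cd[OF _ that] u
      by (auto simp: M_def N_def vec_eq_iff matrix_vector_mult_def edge_matrix_def cdot_def
          image_subset_iff)
    then have "(M' ** M) *v (p v - p u) = transpose A *v (q v - q u)"
      unfolding AT matrix_vector_mul_assoc[symmetric] by simp
    then have "p v - p u = transpose A *v (q v - q u)"
      by (simp only: M' matrix_vector_mul_lid)
    then have "A *v (p v - p u) = (A ** transpose A) *v (q v - q u)"
      by (simp only: matrix_vector_mul_assoc)
    then show ?thesis by (simp add: 2 matrix_vector_mult_diff_distrib algebra_simps)
  qed
  then show ?thesis unfolding congruent_def using 1 2 by blast
qed

section \<open>The distance ring of a generic realisation\<close>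

definition coords :: "('v \<Rightarrow> complex ^ 'n) \<Rightarrow> 'v \<times> 'n \<Rightarrow> complex" where
  "coords p = (\<lambda>(v, i). p v $ i)"

lemma generic_rat_poly_fun_zero:
  fixes p q :: "'v \<Rightarrow> complex ^ 'n"
  assumes "generic V p" "F \<in> rat_poly_funs (V \<times> UNIV)" "F (coords p) = 0"
  shows "F (coords q) = 0"
  using alg_indep_rat_poly_fun_zero[of "coords p" _ F] assms
  by (simp add: generic_def coords_def)

lemma sqdist_rat_poly_fun:
  fixes V :: "'v set"
  assumes "finite V" "v \<in> V" "w \<in> V"
  shows "\<exists>F\<in>rat_poly_funs (V \<times> (UNIV::'n::finite set)). \<forall>p. F (coords p) = sqdist p (v, w)"
proof
  let ?F = "\<lambda>x. \<Sum>i\<in>(UNIV::'n set). (x (v, i) - x (w, i)) * (x (v, i) - x (w, i))"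
  show "?F \<in> rat_poly_funs (V \<times> UNIV)"
    by (intro rat_poly_funs_sum rat_poly_funs_mult rat_poly_funs_diff rat_poly_funs_var)
      (use assms in auto)
  show "\<forall>p. ?F (coords p) = sqdist p (v, w)"
    by (simp add: sqdist_def sqform_def coords_def power2_eq_square)
qed

text \<open>The determinant is a rational polynomial in the coordinates; being nonzero at one
  realisation, it is nonzero at a generic one.\<close>

lemma generic_edge_matrix:
  fixes p :: "'v \<Rightarrow> complex ^ 'n::finite"
  assumes "finite V" "card V \<ge> CARD('n) + 1" "generic V p"
  obtains u f where "u \<in> V" "range f \<subseteq> V" "det (edge_matrix p u f) \<noteq> 0"
proof -
  obtain u where u: "u \<in> V" using assms by fastforce
  have "card (UNIV :: 'n set) \<le> card (V - {u})" using assms u by simp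
  then obtain f :: "'n \<Rightarrow> 'v" where f: "range f \<subseteq> V - {u}" "inj f"
    using card_le_inj[of "UNIV :: 'n set" "V - {u}"] assms by auto
  define F where "F = (\<lambda>x. det (\<chi> i j. x (f i, j) - x (u, j)) :: complex)"
  have F: "F \<in> rat_poly_funs (V \<times> UNIV)" unfolding F_def
    by (intro rat_poly_funs_det rat_poly_funs_diff rat_poly_funs_var) (use assms f u in auto)
  have Fc: "F (coords q) = det (edge_matrix q u f)" for q
    unfolding F_def edge_matrix_def coords_def
    by (intro arg_cong[where f = det]) (simp add: vec_eq_iff)
  \<comment> \<open>The test realisation puts \<open>u\<close> at the origin and each
    \<open>f i\<close> at the \<open>i\<close>-th unit vector, so the edge matrix is the
    identity.\<close>
  define q :: "'v \<Rightarrow> complex ^ 'n" where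
    "q = (\<lambda>v. if v = u then 0 else axis (inv f v) 1)"
  have "f i \<noteq> u" for i using f by auto
  then have "edge_matrix q u f = mat 1"
    by (auto simp: edge_matrix_def q_def vec_eq_iff mat_def axis_def inv_f_f[OF f(2)])
  then have "F (coords q) \<noteq> 0" by (simp add: Fc)
  then have "det (edge_matrix p u f) \<noteq> 0"
    using generic_rat_poly_fun_zero[OF assms(3) F, of q] by (auto simp: Fc)
  then show ?thesis using that u f by blast
qed

text \<open>Meant as the graph of the homomorphism taking the squared distances of \<open>p\<close>
  to those of \<open>q\<close>: \<open>generic_dist_ring_zero\<close> makes it single-valued,
  \<open>partial_iso_dist_ring\<close> injective.\<close>

definition dist_ring ::
    "'v set \<Rightarrow> ('v \<Rightarrow> complex ^ 'n) \<Rightarrow> ('v \<Rightarrow> complex ^ 'n) \<Rightarrow> (complex \<times> complex) set" where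
  "dist_ring V p q = pair_gen ((\<lambda>e. (sqdist p e, sqdist q e)) ` (V \<times> V))"

lemma pair_ring_dist_ring: "pair_ring (dist_ring V p q)"
  by (simp add: dist_ring_def pair_ring_pair_gen)

lemma sqdist_in_dist_ring: "e \<in> V \<times> V \<Longrightarrow> (sqdist p e, sqdist q e) \<in> dist_ring V p q"
  unfolding dist_ring_def by (rule pair_gen.base) blast

text \<open>Every pair in the ring has the form \<open>(F (coords p), F (coords q))\<close> for one
  rational polynomial function \<open>F\<close>; vanishing at a generic \<open>p\<close>, it
  vanishes everywhere.\<close>

lemma generic_dist_ring_zero:
  fixes p q :: "'v \<Rightarrow> complex ^ 'n::finite"
  assumes "finite V" "generic V p" "(0, b) \<in> dist_ring V p q"
  shows "b = 0"
proof -
  let ?S = "(\<lambda>F. (F (coords p), F (coords q))) ` rat_poly_funs (V \<times> UNIV)"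
  have "pair_ring ?S"
    unfolding pair_ring_def
  proof (intro conjI allI impI)
    show "(1, 1) \<in> ?S" using rat_poly_funs_const[of 1 "V \<times> (UNIV::'n set)"] by (force simp: image_iff)
  next
    fix a b c d assume "(a, b) \<in> ?S" "(c, d) \<in> ?S"
    then obtain F G where *: "F \<in> rat_poly_funs (V \<times> UNIV)" "G \<in> rat_poly_funs (V \<times> UNIV)"
      "a = F (coords p)" "b = F (coords q)" "c = G (coords p)" "d = G (coords q)" by auto
    show "(a - c, b - d) \<in> ?S" using rat_poly_funs_diff[OF *(1,2)] by (force simp: *)
    show "(a * c, b * d) \<in> ?S" using rat_poly_funs_mult[OF *(1,2)] by (force simp: *)
  qed
  moreover have "(\<lambda>e. (sqdist p e, sqdist q e)) ` (V \<times> V) \<subseteq> ?S"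
  proof clarify
    fix v w assume "v \<in> V" "w \<in> V"
    from sqdist_rat_poly_fun[OF assms(1) this, where 'n = 'n] obtain F where
      F: "F \<in> rat_poly_funs (V \<times> (UNIV::'n set))" "\<forall>p. F (coords p) = sqdist p (v, w)" by blast
    show "(sqdist p (v, w), sqdist q (v, w)) \<in> ?S"
      by (rule image_eqI[OF _ F(1)]) (simp add: F(2))
  qed
  ultimately have "dist_ring V p q \<subseteq> ?S" unfolding dist_ring_def by (rule pair_gen_subset)
  then obtain F where F: "F \<in> rat_poly_funs (V \<times> UNIV)" "F (coords p) = 0" "F (coords q) = b"
    using assms(3) by force
  from generic_rat_poly_fun_zero[OF assms(2) F(1,2), of q] F(3) show ?thesis by simp
qed

lemma dist_ring_det_gram:
  assumes "u \<in> V" "range f \<subseteq> V"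
  shows "(det (gram_matrix p u f), det (gram_matrix q u f)) \<in> dist_ring V p q"
  unfolding det_def gram_matrix_def
  using assms
  by (auto intro!: pair_ring_sum pair_ring_mult pair_ring_of_int pair_ring_prod pair_ring_add
      pair_ring_diff sqdist_in_dist_ring pair_ring_dist_ring)

lemma countable_dist_ring: "finite V \<Longrightarrow> countable (dist_ring V p q)"
  unfolding dist_ring_def by (intro countable_pair_gen) auto

text \<open>The default 0 turns agreement on \<open>V \<times> V\<close> into equality of functions,
  so distance functions can be counted.\<close>

definition sqdists :: "'v set \<Rightarrow> ('v \<Rightarrow> complex ^ 'n) \<Rightarrow> 'v \<times> 'v \<Rightarrow> complex" where
  "sqdists V p = (\<lambda>e. if e \<in> V \<times> V then sqdist p e else 0)"

lemma sqdists_eq_iff: "sqdists V p = sqdists V q \<longleftrightarrow> (\<forall>e\<in>V \<times> V. sqdist p e = sqdist q e)"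
  by (auto simp: sqdists_def fun_eq_iff)

definition realisations ::
    "'v set \<Rightarrow> 'v set set \<Rightarrow> ('v \<Rightarrow> complex ^ 'n) \<Rightarrow> ('v \<Rightarrow> complex ^ 'n) set" where
  "realisations V E p = {q. (\<forall>v. v \<notin> V \<longrightarrow> q v = 0) \<and> equivalent E p q}"

lemma equivalent_sqdist:
  "equivalent E p q \<longleftrightarrow> (\<forall>v w. {v, w} \<in> E \<longrightarrow> sqdist p (v, w) = sqdist q (v, w))"
  by (simp add: equivalent_def sqdist_def)

lemma simple_graph_edge: "simple_graph V E \<Longrightarrow> {v, w} \<in> E \<Longrightarrow> (v, w) \<in> V \<times> V"
  by (auto simp: simple_graph_def)

text \<open>Each coordinate of \<open>p\<close> is moved along \<open>S\<close>; squared distances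
  are integer polynomials in the coordinates, so they move along.\<close>

lemma partial_iso_realisation:
  fixes p :: "'v \<Rightarrow> complex ^ 'n::finite"
  assumes S: "pair_ring S" and dom: "\<And>v i. v \<in> V \<Longrightarrow> p v $ i \<in> Domain S"
  shows "\<exists>q :: 'v \<Rightarrow> complex ^ 'n. (\<forall>v. v \<notin> V \<longrightarrow> q v = 0) \<and> (\<forall>e\<in>V \<times> V. (sqdist p e, sqdist q e) \<in> S)"
proof -
  define q where "q = (\<lambda>v. if v \<in> V then \<chi> i. SOME b. (p v $ i, b) \<in> S else 0)"
  have q: "(p v $ i, q v $ i) \<in> S" if "v \<in> V" for v i
    using dom[OF that, of i] that by (auto simp: q_def intro: someI)
  have "\<forall>e\<in>V \<times> V. (sqdist p e, sqdist q e) \<in> S"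
    using q unfolding sqdist_def sqform_def
    by (auto intro!: pair_ring_sum pair_ring_power pair_ring_diff S)
  moreover have "\<forall>v. v \<notin> V \<longrightarrow> q v = 0" by (simp add: q_def)
  ultimately show ?thesis by blast
qed

text \<open>An element transcendental over the ring of edge lengths could be moved to uncountably many
places by embeddings fixing all edge lengths, which would give infinitely many realisations.\<close>
lemma dist_ring_algebraic:
  fixes p :: "'v \<Rightarrow> complex ^ 'n::finite" and E :: "'v set set"
  defines "X \<equiv> pair_gen ((\<lambda>e. (sqdist p e, sqdist p e)) ` {(v, w). {v, w} \<in> E})"
  assumes G: "simple_graph V E" and p: "generic V p"
    and fin: "finite (sqdists V ` realisations V E p)"
    and a: "(a, b) \<in> dist_ring V p q"
  shows "\<exists>f g. (f, g) \<in> poly_pairs X \<and> f \<noteq> 0 \<and> poly f a = 0"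
proof (rule ccontr)
  assume contr: "\<not> ?thesis"
  have V: "finite V" using G by (simp add: simple_graph_def)
  \<comment> \<open>\<open>X\<close> is the identity on the ring of edge lengths; extensions of it
    therefore fix all edge lengths.\<close>
  have Xid: "X \<subseteq> Id"
  proof (rule subrelI)
    fix a b assume "(a, b) \<in> X"
    then have "a = b" unfolding X_def by (rule pair_gen_Id) auto
    then show "(a, b) \<in> Id" by simp
  qed
  have Xring: "pair_ring (X)" by (simp add: X_def pair_ring_pair_gen)
  have Xiso: "partial_iso (X)" using Xring Xid by (auto simp: partial_iso_def)
  have "{(v, w). {v, w} \<in> E} \<subseteq> V \<times> V" using simple_graph_edge[OF G] by auto
  then have "finite {(v, w). {v, w} \<in> E}" by (rule finite_subset) (use V in simp)
  then have Xcount: "countable (X)" unfolding X_def by (intro countable_pair_gen) simp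
  define B where "B = (\<Union>(f, g)\<in>poly_pairs X - {(0, 0)}. {z. poly g z = 0})"
  have "countable B"
    unfolding B_def using poly_pairs_zero[OF Xiso]
    by (intro countable_UN countable_Diff countable_poly_pairs Xcount)
      (auto intro!: countable_finite poly_roots_finite)
  then have "infinite (- B)"
    using uncountable_minus_countable[OF uncountable_UNIV_complex]
    by (auto simp: Compl_eq_Diff_UNIV dest: countable_finite)
  \<comment> \<open>The map fixing edge lengths and sending \<open>a\<close> to \<open>d\<close> is
    extended to the coordinates of \<open>p\<close>; their images form the realisation
    \<open>r\<close>.\<close>
  have ex: "\<exists>r\<in>realisations V E p. (a, d) \<in> dist_ring V p r" if "d \<in> - B" for d
  proof -
    have iso: "partial_iso (adjoin (X) a d)"
      using contr that by (intro partial_iso_adjoin_transcendental[OF Xiso]) (auto simp: B_def)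
    have fin': "finite ((\<lambda>(v, i). p v $ i) ` (V \<times> UNIV))" using V by simp
    obtain T where T: "adjoin (X) a d \<subseteq> T" "partial_iso T"
      "(\<lambda>(v, i). p v $ i) ` (V \<times> UNIV) \<subseteq> Domain T"
      using partial_iso_extend_finite[OF iso countable_adjoin[OF Xcount] fin'] by (elim exE conjE)
    have dom: "p v $ i \<in> Domain T" if "v \<in> V" for v i
      using T(3) that by auto
    obtain r :: "'v \<Rightarrow> complex ^ 'n" where r: "\<forall>v. v \<notin> V \<longrightarrow> r v = 0" "\<forall>e\<in>V \<times> V. (sqdist p e, sqdist r e) \<in> T"
      using partial_iso_realisation[OF partial_iso_ring[OF T(2)], of V p] dom by blast
    have XT: "X \<subseteq> T" "(a, d) \<in> T" using T(1) adjoin_supset[OF Xring] by blast+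
    have "sqdist p (v, w) = sqdist r (v, w)" if e: "{v, w} \<in> E" for v w
    proof -
      have "(sqdist p (v, w), sqdist p (v, w)) \<in> T"
        using e by (intro subsetD[OF XT(1)]) (auto simp: X_def intro: pair_gen.base)
      moreover have "(sqdist p (v, w), sqdist r (v, w)) \<in> T"
        using r(2) simple_graph_edge[OF G e] by blast
      ultimately show ?thesis using partial_iso_eq_iff[OF T(2)] by blast
    qed
    then have "r \<in> realisations V E p" using r(1) by (simp add: realisations_def equivalent_sqdist)
    moreover obtain b' where b': "(a, b') \<in> dist_ring V p r"
      using pair_gen_change_snd[of a b "sqdist p" "sqdist q" "V \<times> V" "sqdist r"] a
      unfolding dist_ring_def by blast
    have "dist_ring V p r \<subseteq> T"
      unfolding dist_ring_def using r(2) by (intro pair_gen_subset partial_iso_ring[OF T(2)]) auto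
    then have "b' = d" using partial_iso_eq_iff[OF T(2) _ XT(2), of a b'] b' by blast
    ultimately show ?thesis using b' by blast
  qed
  then obtain r where r: "r d \<in> realisations V E p" "(a, d) \<in> dist_ring V p (r d)" if "d \<in> - B" for d
    by metis
  \<comment> \<open>If two values gave the same distance function, both pairs would lie in one
    distance ring, and their difference \<open>(0, d - d')\<close> forces equality.\<close>
  have "inj_on (\<lambda>d. sqdists V (r d)) (- B)"
  proof (rule inj_onI)
    fix d d' assume d: "d \<in> - B" "d' \<in> - B" and eq: "sqdists V (r d) = sqdists V (r d')"
    have "dist_ring V p (r d) = dist_ring V p (r d')"
      unfolding dist_ring_def
      by (intro arg_cong[where f = pair_gen] image_cong) (use eq in \<open>auto simp: sqdists_eq_iff\<close>)
    then have "(a - a, d - d') \<in> dist_ring V p (r d)"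
      using r(2)[OF d(1)] r(2)[OF d(2)] by (intro pair_ring_diff pair_ring_dist_ring) auto
    then show "d = d'" using generic_dist_ring_zero[OF V p, of "d - d'" "r d"] by simp
  qed
  moreover have "(\<lambda>d. sqdists V (r d)) ` (- B) \<subseteq> sqdists V ` realisations V E p"
    using r by blast
  ultimately have "finite (- B)" using fin by (meson finite_subset inj_on_finite)
  then show False using \<open>infinite (- B)\<close> by simp
qed

text \<open>Suppose a nonzero \<open>a\<close> were sent to 0. The map fixes the coefficients of a
  minimal polynomial of \<open>a\<close> over the edge lengths, so that polynomial also vanishes at
  0; dividing it by the variable contradicts minimality.\<close>

lemma partial_iso_dist_ring:
  fixes p :: "'v \<Rightarrow> complex ^ 'n::finite"
  assumes G: "simple_graph V E" and p: "generic V p"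
    and fin: "finite (sqdists V ` realisations V E p)"
    and q: "q \<in> realisations V E p"
  shows "partial_iso (dist_ring V p q)"
proof -
  note R = pair_ring_dist_ring[of V p q]
  have V: "finite V" using G by (simp add: simple_graph_def)
  define X where "X = pair_gen ((\<lambda>e. (sqdist p e, sqdist p e)) ` {(v, w). {v, w} \<in> E})"
  have "X \<subseteq> dist_ring V p q"
    unfolding X_def
  proof (intro pair_gen_subset R, clarify)
    fix v w assume "{v, w} \<in> E"
    then show "(sqdist p (v, w), sqdist p (v, w)) \<in> dist_ring V p q"
      using sqdist_in_dist_ring[of "(v, w)" V p q] simple_graph_edge[OF G] q
      by (auto simp: realisations_def equivalent_sqdist)
  qed
  have "a = 0" if a: "(a, 0) \<in> dist_ring V p q" for a
  proof (rule ccontr)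
    assume "a \<noteq> 0"
    obtain f0 g0 where "(f0, g0) \<in> poly_pairs X" "f0 \<noteq> 0" "poly f0 a = 0"
      using dist_ring_algebraic[OF G p fin a] unfolding X_def by blast
    then obtain f g where min: "minimal_poly_pair X a f g" using ex_minimal_poly_pair by blast
    then have fg: "(f, g) \<in> poly_pairs X" "f \<noteq> 0" "poly f a = 0"
      by (auto simp: minimal_poly_pair_def)
    have "coeff f i = coeff g i" for i
      using poly_pairs_coeff[OF fg(1), of i] unfolding X_def by (rule pair_gen_Id) auto
    \<comment> \<open>Coefficient pairs lie in \<open>X\<close>, which relates every element only to
      itself.\<close>
    then have "f = g" by (simp add: poly_eq_iff)
    have "(f, f) \<in> poly_pairs (dist_ring V p q)"
      using fg(1) \<open>X \<subseteq> _\<close> unfolding \<open>f = g\<close> poly_pairs_def by auto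
    from pair_ring_poly[OF R this a] have "poly f 0 = 0"
      using generic_dist_ring_zero[OF V p] fg(3) by simp
    then obtain h where h: "f = pCons 0 h" by (cases f) auto
    have "(h, h) \<in> poly_pairs X"
      using fg(1) unfolding \<open>f = g\<close>[symmetric] poly_pairs_def h
      by (auto simp: coeff_pCons_Suc dest: spec[of _ "Suc _"])
    moreover have "poly h a = 0" "degree h < degree f" using fg \<open>a \<noteq> 0\<close> by (auto simp: h)
    ultimately have "h = 0" using min unfolding minimal_poly_pair_def by blast
    then show False using fg(2) h by simp
  qed
  then show ?thesis using R generic_dist_ring_zero[OF V p, of _ q] by (auto simp: partial_iso_def)
qed

section \<open>Counting realisations\<close>

text \<open>An extension of \<open>S\<close> to the coordinates of realisations equivalent to
  \<open>p\<close> moves these to realisations equivalent to \<open>q\<close>, and its injectivity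
  keeps distance functions distinct.\<close>

lemma card_sqdists_realisations_le:
  fixes p q :: "'v \<Rightarrow> complex ^ 'n::finite"
  assumes G: "simple_graph V E" and S: "partial_iso S" "countable S"
    and pq: "\<And>e. e \<in> V \<times> V \<Longrightarrow> (sqdist p e, sqdist q e) \<in> S"
    and fin: "finite (sqdists V ` realisations V E p)" "finite (sqdists V ` realisations V E q)"
  shows "card (sqdists V ` realisations V E p) \<le> card (sqdists V ` realisations V E q)"
proof -
  have V: "finite V" using G by (simp add: simple_graph_def)
  \<comment> \<open>One representative per distance function, so that only finitely many coordinates
    have to be adjoined.\<close>
  obtain Q where Q: "Q \<subseteq> realisations V E p" "inj_on (sqdists V) Q"
    "sqdists V ` realisations V E p = sqdists V ` Q"
    using subset_image_inj[of "sqdists V ` realisations V E p" "sqdists V" "realisations V E p"] by auto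
  have "finite Q" using fin Q by (metis finite_imageD)
  then have fin': "finite ((\<lambda>(r, v, i). r v $ i) ` (Q \<times> V \<times> (UNIV :: 'n set)))" using V by simp
  obtain T where T: "S \<subseteq> T" "partial_iso T"
    "(\<lambda>(r, v, i). r v $ i) ` (Q \<times> V \<times> (UNIV :: 'n set)) \<subseteq> Domain T"
    using partial_iso_extend_finite[OF S fin'] by (elim exE conjE)
  have dom: "r v $ i \<in> Domain T" if "r \<in> Q" "v \<in> V" for r v i
    using T(3) that by force
  have "\<forall>r\<in>Q. \<exists>r' :: 'v \<Rightarrow> complex ^ 'n.
      (\<forall>v. v \<notin> V \<longrightarrow> r' v = 0) \<and> (\<forall>e\<in>V \<times> V. (sqdist r e, sqdist r' e) \<in> T)"
    by (intro ballI partial_iso_realisation partial_iso_ring T(2) dom)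
  from bchoice[OF this] obtain \<phi> :: "('v \<Rightarrow> complex ^ 'n) \<Rightarrow> 'v \<Rightarrow> complex ^ 'n" where
    \<phi>': "\<forall>r\<in>Q. (\<forall>v. v \<notin> V \<longrightarrow> \<phi> r v = 0) \<and>
      (\<forall>e\<in>V \<times> V. (sqdist r e, sqdist (\<phi> r) e) \<in> T)" by blast
  then have \<phi>: "\<And>r v. r \<in> Q \<Longrightarrow> v \<notin> V \<Longrightarrow> \<phi> r v = 0"
    "\<And>r e. r \<in> Q \<Longrightarrow> e \<in> V \<times> V \<Longrightarrow> (sqdist r e, sqdist (\<phi> r) e) \<in> T" by blast+
  have "\<phi> r \<in> realisations V E q" if r: "r \<in> Q" for r
  proof -
    have "sqdist q (v, w) = sqdist (\<phi> r) (v, w)" if e: "{v, w} \<in> E" for v w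
    proof -
      have e': "(v, w) \<in> V \<times> V" using simple_graph_edge[OF G e] .
      have "sqdist p (v, w) = sqdist r (v, w)"
        using r Q(1) e by (auto simp: realisations_def equivalent_sqdist)
      then show ?thesis
        using partial_iso_eq_iff[OF T(2) _ \<phi>(2)[OF r e'], of "sqdist p (v, w)" "sqdist q (v, w)"]
          pq[OF e'] T(1) by blast
    qed
    then show ?thesis using \<phi>(1)[OF r] by (simp add: realisations_def equivalent_sqdist)
  qed
  moreover have "inj_on (\<lambda>r. sqdists V (\<phi> r)) Q"
  proof (rule inj_onI)
    fix r s assume rs: "r \<in> Q" "s \<in> Q" "sqdists V (\<phi> r) = sqdists V (\<phi> s)"
    have "sqdist r e = sqdist s e" if "e \<in> V \<times> V" for e
      using partial_iso_eq_iff[OF T(2) \<phi>(2)[OF rs(1) that] \<phi>(2)[OF rs(2) that]] rs(3) that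
      by (auto simp: sqdists_eq_iff)
    then have "sqdists V r = sqdists V s" by (simp add: sqdists_eq_iff)
    then show "r = s" using Q(2) rs by (auto dest: inj_onD)
  qed
  ultimately have "card Q \<le> card (sqdists V ` realisations V E q)"
    using card_inj_on_le[of "\<lambda>r. sqdists V (\<phi> r)" Q "sqdists V ` realisations V E q"] fin by blast
  then show ?thesis using Q(2,3) by (simp add: card_image)
qed

section \<open>Congruence classes and distance functions\<close>

lemma card_quotient_kernel:
  assumes "\<And>x y. x \<in> R \<Longrightarrow> y \<in> R \<Longrightarrow> P x y \<longleftrightarrow> f x = f y"
  shows "bij_betw (\<lambda>z. {x \<in> R. f x = z}) (f ` R) (R // {(x, y). x \<in> R \<and> y \<in> R \<and> P x y})"
proof -
  have "{(x, y). x \<in> R \<and> y \<in> R \<and> P x y} `` {x} = {y \<in> R. f y = f x}" if "x \<in> R" for x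
    using that assms by auto
  then have "R // {(x, y). x \<in> R \<and> y \<in> R \<and> P x y} = (\<lambda>x. {y \<in> R. f y = f x}) ` R"
    unfolding quotient_def by auto
  moreover have "inj_on (\<lambda>z. {x \<in> R. f x = z}) (f ` R)" by (rule inj_onI) auto
  ultimately show ?thesis by (simp add: bij_betw_def image_image)
qed

lemma congruence_classes_eq:
  "congruence_classes V E p = realisations V E p //
     {(q, q'). q \<in> realisations V E p \<and> q' \<in> realisations V E p \<and> congruent V q q'}"
  by (simp add: congruence_classes_def realisations_def Let_def)

text \<open>Congruence preserves distances, so a distance function can be read off any member of its
  class. The full correspondence, \<open>realisation_congruent_iff\<close>, has this finiteness as a
  hypothesis.\<close>

lemma finite_sqdists_realisations:
  assumes "finite (congruence_classes V E p)"
  shows "finite (sqdists V ` realisations V E p)"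
proof -
  let ?R = "realisations V E p"
  let ?rel = "{(q, q'). q \<in> ?R \<and> q' \<in> ?R \<and> congruent V q q'}"
  have refl: "congruent V q q" for q :: "'a \<Rightarrow> complex ^ 'b"
    unfolding congruent_def by (intro exI[of _ "mat 1"] exI[of _ 0]) (simp add: transpose_mat)
  have "sqdists V q \<in> (\<lambda>C. sqdists V (SOME r. r \<in> C)) ` congruence_classes V E p" if q: "q \<in> ?R" for q
  proof (rule image_eqI)
    show "?rel `` {q} \<in> congruence_classes V E p"
      unfolding congruence_classes_eq using q by (rule quotientI)
    have "q \<in> ?rel `` {q}" using q refl by auto
    then have "(SOME r. r \<in> ?rel `` {q}) \<in> ?rel `` {q}"
      by (rule someI[of "\<lambda>r. r \<in> ?rel `` {q}"])
    then have "congruent V q (SOME r. r \<in> ?rel `` {q})" by blast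
    then show "sqdists V q = sqdists V (SOME r. r \<in> ?rel `` {q})"
      using congruent_imp_sqdist_eq unfolding sqdists_eq_iff by fast
  qed
  then have "sqdists V ` ?R \<subseteq> (\<lambda>C. sqdists V (SOME r. r \<in> C)) ` congruence_classes V E p" by blast
  then show ?thesis by (rule finite_subset) (simp add: assms)
qed

text \<open>For the converse direction \<open>q\<close> must be nondegenerate: the partial
  isomorphism from \<open>p\<close> to \<open>q\<close> keeps the Gram determinant nonzero.\<close>

lemma realisation_congruent_iff:
  fixes p :: "'v \<Rightarrow> complex ^ 'n::finite"
  assumes G: "simple_graph V E" and card: "card V \<ge> CARD('n) + 1" and p: "generic V p"
    and fin: "finite (sqdists V ` realisations V E p)"
    and q: "q \<in> realisations V E p"
  shows "congruent V q r \<longleftrightarrow> sqdists V q = sqdists V r"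
proof
  assume "congruent V q r"
  then show "sqdists V q = sqdists V r"
    using congruent_imp_sqdist_eq unfolding sqdists_eq_iff by fast
next
  assume eq: "sqdists V q = sqdists V r"
  have V: "finite V" using G by (simp add: simple_graph_def)
  obtain u f where u: "u \<in> V" "range f \<subseteq> V" "det (edge_matrix p u f) \<noteq> 0"
    using generic_edge_matrix[OF V card p] .
  have "det (gram_matrix q u f) \<noteq> 0"
    using partial_iso_zero[OF partial_iso_dist_ring[OF G p fin q] dist_ring_det_gram[OF u(1,2)]] u(3)
    by (simp add: det_gram_matrix)
  then have "det (edge_matrix q u f) \<noteq> 0" by (simp add: det_gram_matrix)
  then show "congruent V q r"
    using u eq by (intro sqdist_eq_imp_congruent[of V q r u f]) (auto simp: sqdists_eq_iff)
qed

section \<open>Blocks of equal size and divisibility\<close>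

lemma dvd_card_if_equal_fibres:
  assumes "finite A" "\<And>x. x \<in> A \<Longrightarrow> card {y \<in> A. h y = h x} = k"
  shows "k dvd card A"
proof -
  have "card A = (\<Sum>z\<in>h ` A. card {y \<in> A. h y = z})"
    using sum.image_gen[OF assms(1), of "\<lambda>_. 1::nat" h] by simp
  also have "\<dots> = (\<Sum>z\<in>h ` A. k)" by (intro sum.cong) (use assms in auto)
  finally show ?thesis by simp
qed

text \<open>Distance functions for \<open>EH\<close> are grouped by their values on
  \<open>E\<close>. The block of \<open>q\<close> consists of the distance functions of realisations
  \<open>E\<close>-equivalent to \<open>q\<close>, and the partial isomorphism between
  \<open>p\<close> and \<open>q\<close>, used in both directions, gives it the size of the block of
  \<open>p\<close>.\<close>

lemma dvd_card_sqdists_realisations: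
  fixes p :: "'v \<Rightarrow> complex ^ 'n::finite"
  assumes G: "simple_graph V E" and H: "EH \<subseteq> E" and p: "generic V p"
    and fin: "finite (sqdists V ` realisations V EH p)"
  shows "card (sqdists V ` realisations V E p) dvd card (sqdists V ` realisations V EH p)"
proof (rule dvd_card_if_equal_fibres[OF fin])
  \<comment> \<open>Restriction of a distance function to the edges in \<open>E\<close>; its fibres
    are the blocks.\<close>
  define h where "h = (\<lambda>(y :: 'v \<times> 'v \<Rightarrow> complex) (v, w). if {v, w} \<in> E then y (v, w) else 0)"
  have V: "finite V" using G by (simp add: simple_graph_def)
  have GH: "simple_graph V EH" using G H by (auto simp: simple_graph_def)
  have sub: "realisations V E q \<subseteq> realisations V EH p" if "equivalent EH p q" for q
    using that H by (auto simp: realisations_def equivalent_sqdist subset_iff)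
  fix y assume "y \<in> sqdists V ` realisations V EH p"
  then obtain q where q: "q \<in> realisations V EH p" "y = sqdists V q" by blast
  have pq: "equivalent EH p q" using q by (simp add: realisations_def)
  have h_iff: "h (sqdists V r) = h (sqdists V q) \<longleftrightarrow> equivalent E q r" for r
    using simple_graph_edge[OF G] by (auto simp: h_def fun_eq_iff equivalent_sqdist sqdists_def)
  have "{y' \<in> sqdists V ` realisations V EH p. h y' = h y} = sqdists V ` realisations V E q"
    using sub[OF pq] unfolding q(2) by (auto simp: h_iff realisations_def)
  moreover have "card (sqdists V ` realisations V E p) = card (sqdists V ` realisations V E q)"
  proof (rule antisym)
    have finE: "finite (sqdists V ` realisations V E q)" "finite (sqdists V ` realisations V E p)"
      using fin sub[OF pq] sub[of p] by (simp_all add: equivalent_def finite_subset[OF image_mono])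
    have iso: "partial_iso (dist_ring V p q)" by (rule partial_iso_dist_ring[OF GH p fin q(1)])
    show "card (sqdists V ` realisations V E p) \<le> card (sqdists V ` realisations V E q)"
      by (rule card_sqdists_realisations_le[OF G iso countable_dist_ring[OF V] sqdist_in_dist_ring finE(2,1)])
    \<comment> \<open>The reverse inequality runs the same transport along the converse
      relation.\<close>
    have "countable ((dist_ring V p q)\<inverse>)"
      by (rule countable_subset[OF _ countable_image[OF countable_dist_ring[OF V], of prod.swap p q]]) force
    then show "card (sqdists V ` realisations V E q) \<le> card (sqdists V ` realisations V E p)"
      using sqdist_in_dist_ring[of _ V p q]
      by (intro card_sqdists_realisations_le[OF G partial_iso_converse[OF iso] _ _ finE]) auto
  qed
  ultimately show "card {y' \<in> sqdists V ` realisations V EH p. h y' = h y} =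
      card (sqdists V ` realisations V E p)" by simp
qed

lemma card_congruence_classes:
  fixes p :: "'v \<Rightarrow> complex ^ 'n::finite"
  assumes "simple_graph V E" "card V \<ge> CARD('n) + 1" "generic V p"
    and "finite (sqdists V ` realisations V E p)"
  shows "finite (congruence_classes V E p)"
    and "card (congruence_classes V E p) = card (sqdists V ` realisations V E p)"
proof -
  have "bij_betw (\<lambda>z. {q \<in> realisations V E p. sqdists V q = z})
      (sqdists V ` realisations V E p) (congruence_classes V E p)"
    unfolding congruence_classes_eq
    by (rule card_quotient_kernel) (rule realisation_congruent_iff[OF assms])
  then show "finite (congruence_classes V E p)"
    "card (congruence_classes V E p) = card (sqdists V ` realisations V E p)"
    using assms(4) by (simp_all add: bij_betw_finite bij_betw_same_card)
qed

theorem theorem1p1: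
  fixes V :: "'v set" and E EH :: "'v set set"
  assumes "simple_graph V E"
    and "d_rigid TYPE('n::finite) V E"
    and "card V \<ge> CARD('n) + 1"
    and "EH \<subseteq> E"
    and "d_rigid TYPE('n) V EH"
  shows "realisation_number TYPE('n) V E dvd realisation_number TYPE('n) V EH"
proof -
  \<comment> \<open>The same choice as in \<open>realisation_number\<close>, so both numbers are
    evaluated at one \<open>p\<close>; rigidity supplies a generic realisation, hence the chosen one
    is generic.\<close>
  define p :: "'v \<Rightarrow> complex ^ 'n" where "p = (SOME p. generic V p)"
  have p: "generic V p"
    using assms(2) unfolding p_def d_rigid_def by (metis someI_ex)
  have num: "realisation_number TYPE('n) V F =
      (if finite (congruence_classes V F p) then enat (card (congruence_classes V F p)) else \<infinity>)" for F
    using assms(3) by (simp add: realisation_number_def p_def Let_def)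
  have GH: "simple_graph V EH" using assms(1,4) by (auto simp: simple_graph_def)
  show ?thesis
  proof (cases "finite (congruence_classes V EH p)")
    case True
    then have finH: "finite (sqdists V ` realisations V EH p)" by (rule finite_sqdists_realisations)
    have "realisations V E p \<subseteq> realisations V EH p"
      using assms(4) by (auto simp: realisations_def equivalent_def)
    then have finE: "finite (sqdists V ` realisations V E p)"
      using finH by (meson finite_subset image_mono)
    obtain k where "card (congruence_classes V EH p) = card (congruence_classes V E p) * k"
      using dvd_card_sqdists_realisations[OF assms(1,4) p finH]
        card_congruence_classes(2)[OF GH assms(3) p finH]
        card_congruence_classes(2)[OF assms(1,3) p finE] by auto
    then show ?thesis
      using True card_congruence_classes(1)[OF assms(1,3) p finE]
      by (auto simp: num intro!: dvdI[of _ _ "enat k"])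
  next
    case False
    \<comment> \<open>With the number for \<open>EH\<close> infinite, divisibility needs a nonzero
      number for \<open>E\<close>, since \<open>0 * \<infinity>\<close> is 0; \<open>p\<close>
      itself, reset to 0 outside \<open>V\<close>, gives a class.\<close>
    have "(\<lambda>v. if v \<in> V then p v else 0) \<in> realisations V E p"
      using simple_graph_edge[OF assms(1)] by (auto simp: realisations_def equivalent_def)
    then have "congruence_classes V E p \<noteq> {}"
      unfolding congruence_classes_eq by (auto simp: quotient_def)
    then have "realisation_number TYPE('n) V E \<noteq> 0" by (simp add: num zero_enat_def)
    then have "realisation_number TYPE('n) V E * \<infinity> = \<infinity>" by (simp add: imult_is_infinity)
    then have "realisation_number TYPE('n) V EH = realisation_number TYPE('n) V E * \<infinity>"
      using False by (simp only: num if_False)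
    then show ?thesis by (rule dvdI)
  qed
qed

end
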